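(* Every discrete polymatroid is $M$-shellable. That is, if $\Gamma$ is a discrete polymatroid on variables $x_1,\ldots,x_r$, then the poset $\Gamma$ (ordered by divisibility) admits an $M$-shelling.
   Context: A monomial order ideal $\Gamma$ on variables $x_1,\ldots,x_r$ is a set of monomials $x_1^{a_1}\cdots x_r^{a_r}$ such that $u\in\Gamma$ and $v\mid u$ imply $v\in\Gamma$; it is regarded as a poset ordered by divisibility. It is pure if all its maximal elements have the same degree. For a monomial $m$, $m_i$ denotes the exponent of $x_i$ in $m$. A discrete polymatroid is a pure monomial order ideal $\Gamma$ such that for any two maximal monomials $m,m'\in\Gamma$ and any index $i$ with $m_i>m'_i$, there is an index $j$ with $m_j<m'_j$ and $\frac{x_j}{x_i}m\in\Gamma$. A poset is an $M$-poset if it is isomorphic to the set of monomials dividing some fixed monomial, ordered by divisibility (equivalently, a direct product of finite chains). For $x\le y$ in a poset $P$, the interval $[x,y]$ is an $M$-interval if it is an $M$-poset. An $M$-partition of a pure poset $P$ is a partition of $P$ into $M$-intervals $[x_1,y_1],\ldots,[x_n,y_n]$ with each $y_i$ a maximal element of $P$. An $M$-shelling of $P$ is an $M$-partition together with an ordering of its $M$-intervals such that the union of the elements of any initial subsequence of the intervals is an order ideal (down-closed subset) of $P$. $P$ is $M$-shellable if it admits an $M$-shelling.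
   Formalization: The discrete polymatroid Γ is assumed finite; without this the claim fails (all powers of x_1 have no maximal monomial, so purity and exchange hold vacuously, yet no M-partition exists), and no infinite Γ is M-shellable. *)

theory Defs
  imports "HOL-Library.Multiset" "HOL-Library.Disjoint_Sets"
begin

section \<open>Posets\<close>

text \<open>A poset is given by a carrier \<open>P\<close> and an order \<open>le\<close> on it.\<close>

definition order_ideal :: "'a set \<Rightarrow> ('a \<Rightarrow> 'a \<Rightarrow> bool) \<Rightarrow> 'a set \<Rightarrow> bool" where
  "order_ideal P le D \<longleftrightarrow> D \<subseteq> P \<and> (\<forall>u\<in>D. \<forall>v\<in>P. le v u \<longrightarrow> v \<in> D)"

definition maximal_in :: "'a set \<Rightarrow> ('a \<Rightarrow> 'a \<Rightarrow> bool) \<Rightarrow> 'a \<Rightarrow> bool" where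
  "maximal_in P le y \<longleftrightarrow> y \<in> P \<and> (\<forall>z\<in>P. le y z \<longrightarrow> z = y)"

definition poset_interval :: "'a set \<Rightarrow> ('a \<Rightarrow> 'a \<Rightarrow> bool) \<Rightarrow> 'a \<Rightarrow> 'a \<Rightarrow> 'a set" where
  "poset_interval P le x y = {z \<in> P. le x z \<and> le z y}"

definition poset_isomorphic ::
    "'a set \<Rightarrow> ('a \<Rightarrow> 'a \<Rightarrow> bool) \<Rightarrow> 'b set \<Rightarrow> ('b \<Rightarrow> 'b \<Rightarrow> bool) \<Rightarrow> bool" where
  "poset_isomorphic A leA B leB \<longleftrightarrow>
     (\<exists>f. bij_betw f A B \<and> (\<forall>u\<in>A. \<forall>v\<in>A. leA u v \<longleftrightarrow> leB (f u) (f v)))"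


section \<open>Monomials and discrete polymatroids\<close>

text \<open>
  A monomial \<open>m\<close> is the multiset of (the indices of) its variables: \<open>count m i\<close> is the exponent
  of \<open>x\<^sub>i\<close>, \<open>\<subseteq>#\<close> is divisibility and \<open>size m\<close> is the degree.
\<close>

type_synonym monomial = "nat multiset"

definition monomials :: "nat \<Rightarrow> monomial set" where
  "monomials r = {m. set_mset m \<subseteq> {1..r}}"

definition monomial_order_ideal :: "nat \<Rightarrow> monomial set \<Rightarrow> bool" where
  "monomial_order_ideal r \<Gamma> \<longleftrightarrow> order_ideal (monomials r) (\<subseteq>#) \<Gamma>"

definition pure_monomial_ideal :: "monomial set \<Rightarrow> bool" where
  "pure_monomial_ideal \<Gamma> \<longleftrightarrow>
     (\<forall>m m'. maximal_in \<Gamma> (\<subseteq>#) m \<and> maximal_in \<Gamma> (\<subseteq>#) m' \<longrightarrow> size m = size m')"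

text \<open>
  Discrete polymatroids are finite by convention. Without finiteness, the set of all monomials in
  \<open>r \<ge> 1\<close> variables, which has no maximal element, would satisfy the other conditions vacuously.
  In the exchange property \<open>count m i > 0\<close>, so \<open>add_mset j (m - {#i#})\<close> is \<open>(x\<^sub>j / x\<^sub>i) m\<close>.
\<close>

definition discrete_polymatroid :: "nat \<Rightarrow> monomial set \<Rightarrow> bool" where
  "discrete_polymatroid r \<Gamma> \<longleftrightarrow>
     finite \<Gamma> \<and> monomial_order_ideal r \<Gamma> \<and> pure_monomial_ideal \<Gamma> \<and>
     (\<forall>m m'. maximal_in \<Gamma> (\<subseteq>#) m \<and> maximal_in \<Gamma> (\<subseteq>#) m' \<longrightarrow>
        (\<forall>i\<in>{1..r}. count m i > count m' i \<longrightarrow>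
           (\<exists>j\<in>{1..r}. count m j < count m' j \<and> add_mset j (m - {#i#}) \<in> \<Gamma>)))"


section \<open>M-shellability\<close>

text \<open>The number of variables of the fixed monomial \<open>m\<close> is not bounded.\<close>

definition M_poset :: "'a set \<Rightarrow> ('a \<Rightarrow> 'a \<Rightarrow> bool) \<Rightarrow> bool" where
  "M_poset P le \<longleftrightarrow> (\<exists>m::monomial. poset_isomorphic P le {u. u \<subseteq># m} (\<subseteq>#))"

definition M_partition :: "'a set \<Rightarrow> ('a \<Rightarrow> 'a \<Rightarrow> bool) \<Rightarrow> 'a set set \<Rightarrow> bool" where
  "M_partition P le \<I> \<longleftrightarrow>
     finite \<I> \<and> partition_on P \<I> \<and>
     (\<forall>I\<in>\<I>. \<exists>x\<in>P. \<exists>y. maximal_in P le y \<and> le x y \<and>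
        I = poset_interval P le x y \<and> M_poset I le)"

definition M_shelling :: "'a set \<Rightarrow> ('a \<Rightarrow> 'a \<Rightarrow> bool) \<Rightarrow> 'a set list \<Rightarrow> bool" where
  "M_shelling P le Is \<longleftrightarrow>
     distinct Is \<and> M_partition P le (set Is) \<and>
     (\<forall>k\<le>length Is. order_ideal P le (\<Union>(set (take k Is))))"

definition M_shellable :: "'a set \<Rightarrow> ('a \<Rightarrow> 'a \<Rightarrow> bool) \<Rightarrow> bool" where
  "M_shellable P le \<longleftrightarrow> (\<exists>Is. M_shelling P le Is)"

end

theory Submission
  imports Defs "HOL-Library.Multiset_Order"
begin

text \<open>
  Order the maximal monomials by the multiset order, that is, lexicographically starting from the
  largest variable. If \<open>m'\<close> precedes \<open>m\<close> and \<open>p\<close> is the largest index with \<open>m'\<^sub>p < m\<^sub>p\<close>, then the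
  exchange property yields some \<open>j < p\<close> for which \<open>(x\<^sub>j / x\<^sub>p) m\<close> is a maximal monomial preceding \<open>m\<close>,
  and every common divisor of \<open>m\<close> and \<open>m'\<close> divides \<open>m / x\<^sub>p\<close>. Hence the divisors of \<open>m\<close> that
  divide no earlier maximal monomial are exactly those that contain the full power \<open>x\<^sub>i ^ m\<^sub>i\<close> for
  every \<open>i\<close> admitting an exchange \<open>(x\<^sub>j / x\<^sub>i) m \<in> \<Gamma>\<close> with \<open>j < i\<close>, and they form an interval.
\<close>

text \<open>\<open>filter_mset\<close> keeps all copies of an index or none, so this is a product of
  full powers of variables of \<open>m\<close>. It serves as the bottom of the interval below
  \<open>m\<close>.\<close>

definition restriction :: "monomial set \<Rightarrow> monomial \<Rightarrow> monomial" where
  "restriction \<Gamma> m = filter_mset (\<lambda>i. \<exists>j<i. add_mset j (m - {#i#}) \<in> \<Gamma>) m"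

lemma restriction_subset: "restriction \<Gamma> m \<subseteq># m"
  by (simp add: restriction_def)

lemma monomial_order_ideal_downward:
  assumes "monomial_order_ideal r \<Gamma>" "u \<in> \<Gamma>" "v \<subseteq># u"
  shows "v \<in> \<Gamma>"
proof -
  have "v \<in> monomials r"
    using assms set_mset_mono[OF assms(3)]
    by (auto simp: monomial_order_ideal_def order_ideal_def monomials_def)
  then show ?thesis
    using assms by (auto simp: monomial_order_ideal_def order_ideal_def)
qed

lemma obtains_maximal_above:
  assumes "finite \<Gamma>" "u \<in> \<Gamma>"
  obtains m where "maximal_in \<Gamma> (\<subseteq>#) m" "u \<subseteq># m"
proof -
  obtain m where "m \<in> \<Gamma>" "u \<subseteq># m" "\<And>z. z \<in> \<Gamma> \<Longrightarrow> m \<subseteq># z \<Longrightarrow> z = m"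
    using subset_mset.finite_has_maximal2[OF assms] by metis
  then show ?thesis
    using that by (auto simp: maximal_in_def)
qed

text \<open>A maximal multiple of \<open>u\<close> has the degree of \<open>m\<close> by purity,
  hence that of \<open>u\<close>, and so equals \<open>u\<close>. This turns exchanged monomials
  lying in \<Gamma> into maximal ones.\<close>

lemma maximal_if_size_eq:
  assumes "finite \<Gamma>" "pure_monomial_ideal \<Gamma>" "maximal_in \<Gamma> (\<subseteq>#) m"
    and "u \<in> \<Gamma>" "size u = size m"
  shows "maximal_in \<Gamma> (\<subseteq>#) u"
proof -
  obtain m' where m': "maximal_in \<Gamma> (\<subseteq>#) m'" "u \<subseteq># m'"
    using obtains_maximal_above[OF assms(1,4)] .
  then have "size m' = size u"
    using assms(2,3,5) unfolding pure_monomial_ideal_def by metis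
  then have "u = m'"
    using m'(2) mset_subset_size[of u m'] by (auto simp: subset_mset.le_less)
  with m'(1) show ?thesis
    by simp
qed

text \<open>Division by \<open>x\<close> is the isomorphism; multiplying back stays in \<Gamma>
  because \<Gamma> is closed under divisors.\<close>

lemma M_poset_interval:
  assumes "monomial_order_ideal r \<Gamma>" "y \<in> \<Gamma>" "x \<subseteq># y"
  shows "M_poset (poset_interval \<Gamma> (\<subseteq>#) x y) (\<subseteq>#)"
proof -
  have "bij_betw (\<lambda>u. u - x) (poset_interval \<Gamma> (\<subseteq>#) x y) {u. u \<subseteq># y - x}"
  proof (rule bij_betw_byWitness[where f' = "\<lambda>u. u + x"])
    show "(\<lambda>u. u + x) ` {u. u \<subseteq># y - x} \<subseteq> poset_interval \<Gamma> (\<subseteq>#) x y"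
      using assms monomial_order_ideal_downward[OF assms(1,2)]
      by (auto simp: poset_interval_def subset_mset.le_diff_conv2)
  qed (auto simp: poset_interval_def subset_eq_diff_conv subset_mset.diff_add)
  moreover have "u \<subseteq># v \<longleftrightarrow> u - x \<subseteq># v - x" if "x \<subseteq># u" "x \<subseteq># v" for u v
    using that by (metis subset_eq_diff_conv subset_mset.diff_add)
  ultimately show ?thesis
    unfolding M_poset_def poset_isomorphic_def
    by (intro exI[of _ "y - x"] exI[of _ "\<lambda>u. u - x"]) (auto simp: poset_interval_def)
qed

lemma exchange_with_earlier:
  assumes \<Gamma>: "discrete_polymatroid r \<Gamma>"
    and m: "maximal_in \<Gamma> (\<subseteq>#) m" and m': "maximal_in \<Gamma> (\<subseteq>#) m'" and "m' < m"
  obtains i j where "j < i" "count m' i < count m i" "add_mset j (m - {#i#}) \<in> \<Gamma>"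
proof -
  define D where "D = {i. count m' i < count m i}"
  \<comment> \<open>This is the Huet-Oppen form of \<open>m' < m\<close>: each index where
    \<open>m'\<close> wins lies below one where \<open>m\<close> wins.\<close>
  have D_above: "\<exists>x\<in>D. y < x" if "count m y < count m' y" for y
    using \<open>m' < m\<close> that by (auto simp: less_multiset\<^sub>H\<^sub>O D_def)
  have "D \<noteq> {}"
  proof
    assume "D = {}"
    then have "m = m'"
      using D_above by (metis D_def empty_iff linorder_neqE_nat mem_Collect_eq multiset_eqI)
    with \<open>m' < m\<close> show False by simp
  qed
  have "D \<subseteq> set_mset m"
    by (auto simp: D_def simp flip: count_greater_zero_iff)
  then have "finite D"
    by (rule finite_subset) simp
  define p where "p = Max D"
  have p: "count m' p < count m p"
    using Max_in[OF \<open>finite D\<close> \<open>D \<noteq> {}\<close>] by (simp add: p_def D_def)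
  have "m \<in> monomials r"
    using \<Gamma> m by (auto simp: discrete_polymatroid_def monomial_order_ideal_def order_ideal_def
        maximal_in_def)
  with p have "p \<in> {1..r}"
    by (metis count_greater_zero_iff less_nat_zero_code monomials_def mem_Collect_eq neq0_conv subsetD)
  with \<Gamma> m m' p obtain j
    where j: "count m j < count m' j" "add_mset j (m - {#p#}) \<in> \<Gamma>"
    unfolding discrete_polymatroid_def by blast
  \<comment> \<open>\<open>m'\<close> wins at \<open>j\<close>, so some element of \<open>D\<close>,
    and hence its maximum \<open>p\<close>, exceeds \<open>j\<close>.\<close>
  have "j < p"
    using D_above[OF j(1)] Max_ge[OF \<open>finite D\<close>] by (force simp: p_def)
  with p j(2) show ?thesis
    using that by blast
qed

text \<open>The right-hand side no longer mentions \<open>restriction\<close>: it collects the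
  \<open>u\<close> for which \<open>m\<close> is the least maximal multiple. Disjointness, covering
  and the shelling condition all follow from this form.\<close>

lemma interval_restriction_eq:
  assumes \<Gamma>: "discrete_polymatroid r \<Gamma>" and m: "maximal_in \<Gamma> (\<subseteq>#) m"
  shows "poset_interval \<Gamma> (\<subseteq>#) (restriction \<Gamma> m) m =
    {u \<in> \<Gamma>. u \<subseteq># m \<and> (\<forall>m'. maximal_in \<Gamma> (\<subseteq>#) m' \<and> m' < m \<longrightarrow> \<not> u \<subseteq># m')}"
    (is "?I = ?N")
proof (intro set_eqI iffI)
  fix u
  assume "u \<in> ?I"
  then have u: "u \<in> \<Gamma>" "u \<subseteq># m" "restriction \<Gamma> m \<subseteq># u"
    by (auto simp: poset_interval_def)
  have "\<not> u \<subseteq># m'" if m': "maximal_in \<Gamma> (\<subseteq>#) m'" "m' < m" for m'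
  proof
    assume "u \<subseteq># m'"
    obtain i j where "j < i" and i: "count m' i < count m i"
      and "add_mset j (m - {#i#}) \<in> \<Gamma>"
      using exchange_with_earlier[OF \<Gamma> m m'] .
    then have "count m i = count (restriction \<Gamma> m) i"
      by (auto simp: restriction_def)
    also have "\<dots> \<le> count m' i"
      using u(3) \<open>u \<subseteq># m'\<close> by (meson mset_subset_eq_count order_trans)
    finally show False
      using i by simp
  qed
  with u show "u \<in> ?N"
    by blast
next
  fix u
  assume "u \<in> ?N"
  then have u: "u \<in> \<Gamma>" "u \<subseteq># m"
    and N: "\<And>m'. maximal_in \<Gamma> (\<subseteq>#) m' \<Longrightarrow> m' < m \<Longrightarrow> \<not> u \<subseteq># m'"
    by auto
  have "count m i \<le> count u i"
    if i: "i \<in># m" and "j < i" and ex: "add_mset j (m - {#i#}) \<in> \<Gamma>" for i j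
  proof (rule ccontr)
    assume "\<not> count m i \<le> count u i"
    \<comment> \<open>A missing copy of \<open>i\<close> lets \<open>u\<close> divide
      \<open>m - {#i#}\<close>, and therefore the exchanged monomial, which is maximal and earlier
      than \<open>m\<close>.\<close>
    with u(2) have "u \<subseteq># m - {#i#}"
      by (auto simp: subseteq_mset_def)
    then have "u \<subseteq># add_mset j (m - {#i#})"
      by (metis add_mset_add_single subset_mset.add_increasing2 empty_le)
    moreover have "add_mset j (m - {#i#}) < add_mset i (m - {#i#})"
      using \<open>j < i\<close> by (auto simp: less_multiset\<^sub>H\<^sub>O)
    then have "add_mset j (m - {#i#}) < m"
      using i by simp
    moreover have "size (add_mset j (m - {#i#})) = size m"
      using i by (metis insert_DiffM size_add_mset)
    then have "maximal_in \<Gamma> (\<subseteq>#) (add_mset j (m - {#i#}))"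
      using \<Gamma> m ex by (auto simp: discrete_polymatroid_def intro: maximal_if_size_eq)
    ultimately show False
      using N by blast
  qed
  then have "count (restriction \<Gamma> m) i \<le> count u i" for i
    by (cases "i \<in># m") (auto simp: restriction_def not_in_iff)
  then have "restriction \<Gamma> m \<subseteq># u"
    by (simp add: subseteq_mset_def)
  with u show "u \<in> ?I"
    by (simp add: poset_interval_def)
qed

theorem theorem2p1:
  fixes r :: nat and \<Gamma> :: "nat multiset set"
  assumes "discrete_polymatroid r \<Gamma>"
  shows "M_shellable \<Gamma> (\<subseteq>#)"
proof -
  have fin: "finite \<Gamma>" and ideal: "monomial_order_ideal r \<Gamma>"
    using assms by (auto simp: discrete_polymatroid_def)
  define B where "B = {m. maximal_in \<Gamma> (\<subseteq>#) m}"
  define I where "I m = poset_interval \<Gamma> (\<subseteq>#) (restriction \<Gamma> m) m" for m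
  \<comment> \<open>The sorting uses the multiset order, which is linear because the order on
    indices is.\<close>
  define bs where "bs = sorted_list_of_set B"
  have "B \<subseteq> \<Gamma>"
    by (auto simp: B_def maximal_in_def)
  then have "finite B"
    using fin finite_subset by blast
  then have bs: "set bs = B" "sorted bs" "distinct bs"
    by (auto simp: bs_def)
  have I_eq: "I m = {u \<in> \<Gamma>. u \<subseteq># m \<and> (\<forall>m'\<in>B. m' < m \<longrightarrow> \<not> u \<subseteq># m')}" if "m \<in> B" for m
    using that interval_restriction_eq[OF assms] by (auto simp: B_def I_def)
  have I_self: "m \<in> I m" if "m \<in> B" for m
    using that \<open>B \<subseteq> \<Gamma>\<close> restriction_subset by (auto simp: I_def poset_interval_def)
  \<comment> \<open>If \<open>m\<close> and \<open>m'\<close> differed, \<open>u\<close> would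
    divide the smaller one and so be excluded from the interval of the larger.\<close>
  have unique: "m = m'" if "m \<in> B" "m' \<in> B" "u \<in> I m" "u \<in> I m'" for m m' u
    using that by (metis (no_types, lifting) I_eq linorder_neqE mem_Collect_eq)
  \<comment> \<open>The witness is the least element of \<open>B\<close> that \<open>u\<close>
    divides.\<close>
  have first: "\<exists>m0\<in>B. m0 \<le> m \<and> u \<in> I m0" if "m \<in> B" "u \<in> \<Gamma>" "u \<subseteq># m" for m u
  proof -
    let ?M = "{m\<in>B. u \<subseteq># m}"
    have "finite ?M" "m \<in> ?M"
      using \<open>finite B\<close> that by auto
    then have "Min ?M \<in> ?M" "Min ?M \<le> m" "\<And>m'. m' \<in> ?M \<Longrightarrow> \<not> m' < Min ?M"
      using Min_in[of ?M] by (auto simp: not_less)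
    then show ?thesis
      using I_eq \<open>u \<in> \<Gamma>\<close> by blast
  qed
  \<comment> \<open>Injectivity makes the list of intervals distinct.\<close>
  have "inj_on I B"
    by (metis I_self inj_onI unique)
  have initial: "order_ideal \<Gamma> (\<subseteq>#) (\<Union>(set (take k (map I bs))))" for k
    unfolding order_ideal_def
  proof (intro conjI ballI impI)
    show "\<Union>(set (take k (map I bs))) \<subseteq> \<Gamma>"
      by (auto simp: take_map I_def poset_interval_def)
  next
    fix u v
    assume "u \<in> \<Union>(set (take k (map I bs)))" and v: "v \<in> \<Gamma>" "v \<subseteq># u"
    then obtain m where m: "m \<in> set (take k bs)" "u \<in> I m"
      by (auto simp: take_map)
    then have "m \<in> B"
      using bs(1) set_take_subset by fastforce
    moreover have "v \<subseteq># m"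
      using m(2) v(2) by (auto simp: I_def poset_interval_def)
    \<comment> \<open>Since \<open>v\<close> also divides \<open>m\<close>, its own interval belongs
      to \<open>m\<close> or to an earlier element, which the initial segment of \<open>bs\<close>
      must contain.\<close>
    ultimately obtain m0 where m0: "m0 \<in> B" "m0 \<le> m" "v \<in> I m0"
      using first v(1) by blast
    have "m0 \<in> set (take k bs)"
    proof (rule ccontr)
      assume "m0 \<notin> set (take k bs)"
      then have "m0 \<in> set (drop k bs)"
        using m0(1) bs(1) by (metis Un_iff append_take_drop_id set_append)
      then have "m \<le> m0"
        using m(1) bs(2) by (metis append_take_drop_id sorted_append)
      with m0(2) \<open>m0 \<notin> set (take k bs)\<close> m(1) show False
        by simp
    qed
    with m0(3) show "v \<in> \<Union>(set (take k (map I bs)))"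
      by (auto simp: take_map)
  qed
  have "partition_on \<Gamma> (I ` B)"
  proof (rule partition_onI)
    show "\<Union>(I ` B) = \<Gamma>"
    proof
      show "\<Gamma> \<subseteq> \<Union>(I ` B)"
      proof
        fix u
        assume "u \<in> \<Gamma>"
        then obtain m where "m \<in> B" "u \<subseteq># m"
          using obtains_maximal_above[OF fin] by (auto simp: B_def)
        with first \<open>u \<in> \<Gamma>\<close> show "u \<in> \<Union>(I ` B)"
          by blast
      qed
    qed (auto simp: I_def poset_interval_def)
    show "{} \<notin> I ` B"
      using I_self by auto
    show "disjnt p q" if "p \<in> I ` B" "q \<in> I ` B" "p \<noteq> q" for p q
      using that unique by (auto simp: disjnt_iff)
  qed
  moreover have "\<exists>x\<in>\<Gamma>. \<exists>y. maximal_in \<Gamma> (\<subseteq>#) y \<and> x \<subseteq># y \<and>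
      I m = poset_interval \<Gamma> (\<subseteq>#) x y \<and> M_poset (I m) (\<subseteq>#)" if "m \<in> B" for m
  proof (intro bexI exI conjI)
    have "m \<in> \<Gamma>"
      using that \<open>B \<subseteq> \<Gamma>\<close> by blast
    then show "restriction \<Gamma> m \<in> \<Gamma>"
      using monomial_order_ideal_downward[OF ideal] restriction_subset by blast
    show "M_poset (I m) (\<subseteq>#)"
      unfolding I_def by (rule M_poset_interval[OF ideal \<open>m \<in> \<Gamma>\<close> restriction_subset])
  qed (use that in \<open>auto simp: B_def I_def restriction_subset\<close>)
  ultimately have "M_partition \<Gamma> (\<subseteq>#) (set (map I bs))"
    using \<open>finite B\<close> bs(1) by (auto simp: M_partition_def)
  then have "M_shelling \<Gamma> (\<subseteq>#) (map I bs)"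
    using initial bs \<open>inj_on I B\<close> by (simp add: M_shelling_def distinct_map)
  then show ?thesis
    by (auto simp: M_shellable_def)
qed

end
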